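(* Let $w \in W = W(\widetilde A_{n-1})$. The following are equivalent: (i) $w$ is fully commutative (considering $W$ as a Coxeter group); (ii) if $a, b \in \mathbb{Z}$ with $a < b$ and we have $w(a) > w(b)$, then $w(a) > a$ and $w(b) < b$; (iii) $w$ is $321$-avoiding (considering $W$ as a George group); (iv) there are no positive roots $\alpha, \beta, \alpha + \beta$ in the root system of type $\widetilde A_{n-1}$ such that $w(\alpha) < 0$ and $w(\beta) < 0$.
   Context: Let $n \geq 3$ and let $W$ be the affine Weyl group of type $\widetilde A_{n-1}$, with Coxeter generators $s_1, \ldots, s_n$ (indices modulo $n$, $s_i s_j s_i = s_j s_i s_j$ for adjacent $i,j$ in the cyclic Dynkin diagram, $s_i s_j = s_j s_i$ otherwise). It is realized as the group of permutations $w$ of $\mathbb{Z}$ with $w(i+n) = w(i)+n$ and $\sum_{t=1}^n w(t) = \sum_{t=1}^n t$, where $s_i$ sends $t \mapsto t+1$ if $t \equiv i \mod n$, $t \mapsto t-1$ if $t \equiv i+1 \mod n$, and fixes $t$ otherwise. An element $w$ is fully commutative if no reduced expression for $w$ contains a subword $s_i s_j s_i$; it is $321$-avoiding if there are no integers $a < b < c$ with $w(a) > w(b) > w(c)$. *)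

theory Defs
  imports Complex_Main
begin

text \<open>
  The affine Weyl group of type A~(n-1) in its realization by permutations of the integers
  (a George group). Products in the group are compositions of maps.
\<close>

definition affine_weyl :: "nat \<Rightarrow> (int \<Rightarrow> int) set" where
  "affine_weyl n = {w. bij w \<and> (\<forall>i. w (i + int n) = w i + int n) \<and>
     (\<Sum>t = 1..int n. w t) = (\<Sum>t = 1..int n. t)}"

definition cox_gen :: "nat \<Rightarrow> int \<Rightarrow> int \<Rightarrow> int" where
  "cox_gen n i t =
     (if t mod int n = i mod int n then t + 1
      else if t mod int n = (i + 1) mod int n then t - 1
      else t)"

definition word_prod :: "nat \<Rightarrow> int list \<Rightarrow> int \<Rightarrow> int" where
  "word_prod n ks = foldr (\<lambda>i f. cox_gen n i \<circ> f) ks id"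

definition expression :: "nat \<Rightarrow> int list \<Rightarrow> (int \<Rightarrow> int) \<Rightarrow> bool" where
  "expression n ks w \<longleftrightarrow> set ks \<subseteq> {1..int n} \<and> word_prod n ks = w"

definition reduced_expression :: "nat \<Rightarrow> int list \<Rightarrow> (int \<Rightarrow> int) \<Rightarrow> bool" where
  "reduced_expression n ks w \<longleftrightarrow>
     expression n ks w \<and> (\<forall>js. expression n js w \<longrightarrow> length ks \<le> length js)"

text \<open>
  Subwords are contiguous. No adjacency of \<open>i\<close> and \<open>j\<close> is required: if \<open>i = j\<close>, or if the two
  generators commute, a word containing \<open>i, j, i\<close> is not reduced anyway.
\<close>

definition fully_commutative :: "nat \<Rightarrow> (int \<Rightarrow> int) \<Rightarrow> bool" where
  "fully_commutative n w \<longleftrightarrow>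
     \<not> (\<exists>ks xs ys i j. reduced_expression n ks w \<and> ks = xs @ [i, j, i] @ ys)"

definition avoids_321 :: "(int \<Rightarrow> int) \<Rightarrow> bool" where
  "avoids_321 w \<longleftrightarrow> \<not> (\<exists>a b c. a < b \<and> b < c \<and> w a > w b \<and> w b > w c)"

text \<open>
  The root system of the Coxeter group, in its geometric representation. A vector is given by its
  coordinates with respect to the simple roots, which are indexed by \<open>{1..n}\<close>; coordinates at
  all other indices are 0. For \<open>n \<ge> 3\<close> the Cartan matrix is twice the matrix
  \<open>- cos (pi / m i j)\<close> of the canonical bilinear form, where \<open>m\<close> is the Coxeter matrix.
\<close>

definition cartan :: "nat \<Rightarrow> int \<Rightarrow> int \<Rightarrow> real" where
  "cartan n i j =
     (if i = j then 2
      else if (i - j) mod int n = 1 \<or> (j - i) mod int n = 1 then -1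
      else 0)"

definition simple_root :: "int \<Rightarrow> int \<Rightarrow> real" where
  "simple_root i = (\<lambda>j. if j = i then 1 else 0)"

definition simple_refl :: "nat \<Rightarrow> int \<Rightarrow> (int \<Rightarrow> real) \<Rightarrow> (int \<Rightarrow> real)" where
  "simple_refl n i v = (\<lambda>k. v k - (\<Sum>j = 1..int n. cartan n i j * v j) * simple_root i k)"

text \<open>
  The action of the group on vectors, in which the generator \<open>s\<^sub>i\<close> acts as the simple reflection
  for \<open>i\<close>. The lemma \<open>weyl_act_word_prod\<close> below shows that the result does not depend on
  the expression chosen.
\<close>

definition weyl_act :: "nat \<Rightarrow> (int \<Rightarrow> int) \<Rightarrow> (int \<Rightarrow> real) \<Rightarrow> (int \<Rightarrow> real)" where
  "weyl_act n w v = (THE u. \<exists>ks. expression n ks w \<and> u = foldr (simple_refl n) ks v)"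

text \<open>
  The orbit of the simple roots, that is, the real roots. The multiples of the null root, which
  is fixed by the group, are not included.
\<close>

inductive_set roots :: "nat \<Rightarrow> (int \<Rightarrow> real) set" for n :: nat where
  simple: "i \<in> {1..int n} \<Longrightarrow> simple_root i \<in> roots n"
| refl: "\<alpha> \<in> roots n \<Longrightarrow> i \<in> {1..int n} \<Longrightarrow> simple_refl n i \<alpha> \<in> roots n"

definition positive_roots :: "nat \<Rightarrow> (int \<Rightarrow> real) set" where
  "positive_roots n = {\<alpha> \<in> roots n. \<forall>i. 0 \<le> \<alpha> i}"

definition negative_roots :: "nat \<Rightarrow> (int \<Rightarrow> real) set" where
  "negative_roots n = {\<alpha> \<in> roots n. \<forall>i. \<alpha> i \<le> 0}"


text \<open>
  Well-definedness of the action. The pairing of a vector \<open>v\<close> with a map \<open>f\<close> satisfying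
  \<open>f (t + n) = f t + c\<close> sends the \<open>i\<close>-th simple root to \<open>f (i + 1) - f i\<close>; the simple
  reflections are adjoint to composition with the generators.
\<close>

definition root_pair :: "nat \<Rightarrow> (int \<Rightarrow> real) \<Rightarrow> (int \<Rightarrow> real) \<Rightarrow> real" where
  "root_pair n v f = (\<Sum>j = 1..int n. v j * (f (j + 1) - f j))"

lemma mod_eq_near:
  fixes x y m :: int
  assumes "m > 0" and "\<bar>x - y\<bar> < 2 * m"
  shows "x mod m = y mod m \<longleftrightarrow> x = y \<or> x = y + m \<or> x = y - m"
proof
  assume "x mod m = y mod m"
  then obtain k where k: "x - y = m * k"
    by (metis dvd_def mod_eq_dvd_iff)
  have "m * k < m * 2" "m * (-2) < m * k"
    using assms k by linarith+
  then have "k < 2" "-2 < k"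
    using assms(1) by (simp_all only: mult_less_cancel_left_pos)
  then have "k = 0 \<or> k = 1 \<or> k = -1" by linarith
  then show "x = y \<or> x = y + m \<or> x = y - m" using k by auto
next
  assume "x = y \<or> x = y + m \<or> x = y - m"
  then show "x mod m = y mod m" by auto
qed

lemma diff_mod_eq_1:
  fixes x y m :: int
  assumes "m > 1"
  shows "(x - y) mod m = 1 \<longleftrightarrow> x mod m = (y + 1) mod m"
proof -
  have "(x - y) mod m = 1 \<longleftrightarrow> (x - y) mod m = 1 mod m" using assms by simp
  also have "\<dots> \<longleftrightarrow> x mod m = (y + 1) mod m"
    by (simp add: mod_eq_dvd_iff algebra_simps)
  finally show ?thesis .
qed

lemma cox_gen_diff:
  assumes n: "n \<ge> 3" and i: "i \<in> {1..int n}" and j: "j \<in> {1..int n}"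
    and f: "\<And>t. f (t + int n) = f t + (c::real)"
  shows "f (cox_gen n i (j + 1)) - f (cox_gen n i j) =
    (f (j + 1) - f j) - cartan n i j * (f (i + 1) - f i)"
proof -
  have n': "int n > 1" "int n > 0" "int n \<ge> 3" using n by auto
  have m: "x mod int n = y mod int n \<longleftrightarrow> x = y \<or> x = y + int n \<or> x = y - int n"
    if "\<bar>x - y\<bar> < 2 * int n" for x y
    using mod_eq_near[OF n'(2) that] .
  have c0: "j mod int n = i mod int n \<longleftrightarrow> j = i"
    using i j n' by (subst m) auto
  have c1: "(j + 1) mod int n = i mod int n \<longleftrightarrow> j = i - 1 \<or> j = i - 1 + int n"
    using i j n' by (subst m) auto
  have c2: "j mod int n = (i + 1) mod int n \<longleftrightarrow> j = i + 1 \<or> j = i + 1 - int n"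
    using i j n' by (subst m) auto
  have c3: "(j + 1) mod int n = (i + 1) mod int n \<longleftrightarrow> j = i"
    using i j n' by (subst m) auto
  have c4: "i mod int n = (j + 1) mod int n \<longleftrightarrow> j = i - 1 \<or> j = i - 1 + int n"
    using c1 by metis
  note c = c0 c1 c2 c3 c4
  have f': "f (t - int n) = f t - c" for t
    using f[of "t - int n"] by simp
  consider "j = i" | "j = i - 1" | "j = i - 1 + int n" | "j = i + 1" | "j = i + 1 - int n"
    | "j \<noteq> i" "j \<noteq> i - 1" "j \<noteq> i - 1 + int n" "j \<noteq> i + 1" "j \<noteq> i + 1 - int n"
    by blast
  then show ?thesis
  proof cases
    case 1
    then show ?thesis using c n by (simp add: cox_gen_def cartan_def)
  next
    case 2
    then have "cox_gen n i (j + 1) = i + 1" "cox_gen n i j = j" "cartan n i j = -1"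
      using c n' by (auto simp: cox_gen_def cartan_def diff_mod_eq_1)
    then show ?thesis using 2 by simp
  next
    case 3
    then have "cox_gen n i (j + 1) = i + 1 + int n" "cox_gen n i j = j" "cartan n i j = -1"
      using c n' by (auto simp: cox_gen_def cartan_def diff_mod_eq_1)
    moreover have "f (j + 1) = f i + c" using 3 f[of i] by simp
    ultimately show ?thesis using f[of "i + 1"] by simp
  next
    case 4
    then have "cox_gen n i (j + 1) = j + 1" "cox_gen n i j = i" "cartan n i j = -1"
      using c n' by (auto simp: cox_gen_def cartan_def diff_mod_eq_1)
    then show ?thesis using 4 by simp
  next
    case 5
    then have "cox_gen n i (j + 1) = j + 1" "cox_gen n i j = i - int n" "cartan n i j = -1"
      using c n' by (auto simp: cox_gen_def cartan_def diff_mod_eq_1)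
    moreover have "f j = f (i + 1) - c" using 5 f'[of "i + 1"] by simp
    ultimately show ?thesis using f'[of i] by simp
  next
    case 6
    then have "cox_gen n i (j + 1) = j + 1" "cox_gen n i j = j" "cartan n i j = 0"
      using c n' by (auto simp: cox_gen_def cartan_def diff_mod_eq_1)
    then show ?thesis by simp
  qed
qed

lemma cox_gen_periodic: "cox_gen n i (t + int n) = cox_gen n i t + int n"
  by (simp add: cox_gen_def)

lemma root_pair_simple_refl:
  assumes n: "n \<ge> 3" and i: "i \<in> {1..int n}"
    and f: "\<And>t. f (t + int n) = f t + (c::real)"
  shows "root_pair n (simple_refl n i v) f = root_pair n v (f \<circ> cox_gen n i)"
proof -
  let ?S = "\<Sum>j = 1..int n. cartan n i j * v j"
  let ?d = "\<lambda>j. f (j + 1) - f j"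
  have "root_pair n (simple_refl n i v) f =
      (\<Sum>j = 1..int n. v j * ?d j) - (\<Sum>j = 1..int n. if j = i then ?S * ?d i else 0)"
    unfolding root_pair_def simple_refl_def simple_root_def sum_subtractf[symmetric]
    by (rule sum.cong) (auto simp: algebra_simps)
  also have "\<dots> = (\<Sum>j = 1..int n. v j * ?d j) - ?S * ?d i"
    using i by (subst sum.delta) auto
  also have "\<dots> = (\<Sum>j = 1..int n. v j * (?d j - cartan n i j * ?d i))"
    unfolding sum_distrib_right sum_subtractf[symmetric]
    by (rule sum.cong) (auto simp: algebra_simps)
  also have "\<dots> = root_pair n v (f \<circ> cox_gen n i)"
    unfolding root_pair_def using cox_gen_diff[where f = f and c = c, OF n i _ f]
    by (intro sum.cong) (auto simp: o_def)
  finally show ?thesis .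
qed

lemma root_pair_foldr:
  assumes "n \<ge> 3" and "set ks \<subseteq> {1..int n}"
    and "\<And>t. f (t + int n) = f t + (c::real)"
  shows "root_pair n (foldr (simple_refl n) ks v) f = root_pair n v (f \<circ> word_prod n ks)"
  using assms(2,3)
proof (induction ks arbitrary: f)
  case Nil
  then show ?case by (simp add: word_prod_def)
next
  case (Cons i ks)
  have "root_pair n (foldr (simple_refl n) (i # ks) v) f =
      root_pair n (foldr (simple_refl n) ks v) (f \<circ> cox_gen n i)"
    using root_pair_simple_refl[of n i f c] assms(1) Cons.prems by simp
  also have "\<dots> = root_pair n v ((f \<circ> cox_gen n i) \<circ> word_prod n ks)"
    using Cons.prems by (intro Cons.IH) (auto simp: cox_gen_periodic)
  finally show ?case by (simp add: word_prod_def o_def)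
qed

lemma simple_refl_outside: "i \<in> {1..int n} \<Longrightarrow> k \<notin> {1..int n} \<Longrightarrow> simple_refl n i v k = v k"
  by (auto simp: simple_refl_def simple_root_def)

lemma foldr_simple_refl_outside:
  "set ks \<subseteq> {1..int n} \<Longrightarrow> k \<notin> {1..int n} \<Longrightarrow> foldr (simple_refl n) ks v k = v k"
  by (induction ks) (auto simp del: atLeastAtMost_iff simp: simple_refl_outside)

lemma div_step:
  fixes x m :: int
  assumes "m > 0"
  shows "(x + 1) div m - x div m = (if (x + 1) mod m = 0 then 1 else 0)"
proof (cases "(x + 1) mod m = 0")
  case True
  then obtain q where q: "x + 1 = m * q" by (auto simp: dvd_def mod_eq_0_iff_dvd)
  have "x = m * (q - 1) + (m - 1)" using q by (simp add: algebra_simps)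
  then have "x div m = q - 1" using assms by (intro int_div_pos_eq[where r = "m - 1"]) auto
  moreover have "(x + 1) div m = q" using q assms by simp
  ultimately show ?thesis using True by simp
next
  case False
  define q r where "q = (x + 1) div m" and "r = (x + 1) mod m"
  have qr: "x + 1 = m * q + r" by (simp add: q_def r_def)
  have r: "0 < r" "r < m" using False assms pos_mod_sign[of m "x + 1"] pos_mod_bound[of m "x + 1"]
    unfolding r_def by linarith+
  have "x = (r - 1) + m * q" using qr by simp
  then have "x div m = q + (r - 1) div m" using assms by (metis div_mult_self2 less_irrefl)
  also have "(r - 1) div m = 0" using r by simp
  finally show ?thesis using False by (simp add: q_def)
qed

lemma root_pair_separates:
  assumes n: "n \<ge> 3" and k: "k \<in> {1..int n}"
  obtains f where "\<And>t. f (t + int n) = f t + (1::real)" and "\<And>v. root_pair n v f = v k"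
proof
  let ?f = "\<lambda>t. real_of_int ((t - k - 1) div int n)"
  have n': "int n > 0" using n by simp
  show "?f (t + int n) = ?f t + 1" for t
  proof -
    have "t + int n - k - 1 = (t - k - 1) + int n" by simp
    then show ?thesis using n' by (simp only: div_add_self2)
  qed
  have "?f (j + 1) - ?f j = (if j = k then 1 else 0)" if "j \<in> {1..int n}" for j
  proof -
    have "?f (j + 1) - ?f j = real_of_int ((j - k - 1 + 1) div int n - (j - k - 1) div int n)"
      by (simp add: algebra_simps)
    also have "\<dots> = (if (j - k) mod int n = 0 then 1 else 0)"
      by (subst div_step[OF n']) simp
    also have "(j - k) mod int n = 0 \<longleftrightarrow> j mod int n = k mod int n"
      by (simp add: mod_eq_0_iff_dvd mod_eq_dvd_iff)
    also have "\<dots> \<longleftrightarrow> j = k"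
      using mod_eq_near[OF n', of j k] that k by auto
    finally show ?thesis .
  qed
  then have "root_pair n v ?f = (\<Sum>j = 1..int n. if j = k then v k else 0)" for v
    unfolding root_pair_def by (intro sum.cong) auto
  then show "root_pair n v ?f = v k" for v
    using k by simp
qed

lemma weyl_act_word_prod:
  assumes n: "n \<ge> 3" and ks: "set ks \<subseteq> {1..int n}"
  shows "weyl_act n (word_prod n ks) v = foldr (simple_refl n) ks v"
  unfolding weyl_act_def
proof (rule the_equality)
  show "\<exists>js. expression n js (word_prod n ks) \<and>
      foldr (simple_refl n) ks v = foldr (simple_refl n) js v"
    using ks by (auto simp: expression_def)
next
  fix u
  assume "\<exists>js. expression n js (word_prod n ks) \<and> u = foldr (simple_refl n) js v"
  then obtain js where js: "set js \<subseteq> {1..int n}" "word_prod n js = word_prod n ks"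
      and u: "u = foldr (simple_refl n) js v"
    by (auto simp: expression_def)
  show "u = foldr (simple_refl n) ks v"
  proof
    fix k
    show "u k = foldr (simple_refl n) ks v k"
    proof (cases "k \<in> {1..int n}")
      case True
      obtain f where f: "\<And>t. f (t + int n) = f t + (1::real)"
          and sep: "\<And>v. root_pair n v f = v k"
        using root_pair_separates[OF n True] by blast
      show ?thesis
        unfolding u using root_pair_foldr[where f = f and c = 1 and v = v, OF n js(1) f]
            root_pair_foldr[where f = f and c = 1 and v = v, OF n ks f]
        by (simp add: sep js(2))
    next
      case False
      then show ?thesis
        using foldr_simple_refl_outside[OF js(1)] foldr_simple_refl_outside[OF ks] u by metis
    qed
  qed
qed

end

theory Submission imports Defs begin

text \<open>
  The length of \<open>w\<close> is the number of inversions \<open>(a, b)\<close> up to simultaneous shifts by \<open>n\<close>, so a word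
  is reduced iff every letter \<open>s\<^sub>k\<close> is appended at an ascent. Hence inversions persist along a reduced
  word, and a factor \<open>s\<^sub>i s\<^sub>j s\<^sub>i\<close>, which creates a descending triple, forces a 321 pattern. Conversely,
  a 321 pattern is squeezed, by descents that shorten \<open>w\<close> or by replacing an outer entry, until its
  three positions are consecutive; there \<open>w\<close> ends in a braid. The pointwise criterion comes from
  counting crossings: if a value moves down across a point, some value moves up across it. The real
  roots correspond to pairs \<open>(a, b)\<close> with \<open>a\<close>, \<open>b\<close> incongruent, up to shifts, \<open>w\<close> acts on them by
  \<open>(w a, w b)\<close>, and positivity means \<open>a < b\<close>; a sum of two real roots is a real root only if the
  pairs can be shifted so as to share an entry.
\<close>

section \<open>Quasi-periodic maps, windows and words\<close>

lemma quasi_periodic_shift: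
  fixes f :: "int \<Rightarrow> 'a::comm_ring_1"
  assumes "\<And>t. f (t + m) = f t + c"
  shows "f (t + k * m) = f t + of_int k * c"
proof (induction k rule: int_induct[where k = 0])
  case base
  then show ?case by simp
next
  case (step1 k)
  then show ?case using assms[of "t + k * m"] by (simp add: algebra_simps)
next
  case (step2 k)
  then show ?case using assms[of "t + (k - 1) * m"] by (simp add: algebra_simps)
qed

text \<open>Moving a window by one place trades its first summand for an equal one at the other
  end.\<close>

lemma sum_periodic_window:
  fixes g :: "int \<Rightarrow> 'a::ab_group_add"
  assumes "m > 0" and g: "\<And>t. g (t + m) = g t"
  shows "(\<Sum>t = x..<x + m. g t) = (\<Sum>t = y..<y + m. g t)"
proof -
  have step: "(\<Sum>t = x..<x + m. g t) = (\<Sum>t = x + 1..<x + 1 + m. g t)" for x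
  proof -
    have "{x..<x + m} = insert x {x + 1..<x + m}" "{x + 1..<x + 1 + m} = insert (x + m) {x + 1..<x + m}"
      using assms(1) by auto
    then show ?thesis using g[of x] by simp
  qed
  have "(\<Sum>t = x..<x + m. g t) = (\<Sum>t = 0..<0 + m. g t)" for x
  proof (induction x rule: int_induct[where k = 0])
    case (step2 i)
    then show ?case using step[of "i - 1"] by simp
  qed (use step in auto)
  then show ?thesis by metis
qed

lemma eq_add_mult_if_mod_eq:
  fixes a b m :: int
  assumes "a mod m = b mod m"
  obtains k where "b = a + k * m"
proof -
  have "m dvd b - a" using assms by (metis mod_eq_dvd_iff)
  then obtain k where "b - a = m * k" by blast
  then show ?thesis using that[of k] by (simp add: algebra_simps)
qed

lemma word_prod_Nil [simp]: "word_prod n [] = id"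
  by (simp add: word_prod_def)

lemma word_prod_Cons [simp]: "word_prod n (k # ks) = cox_gen n k \<circ> word_prod n ks"
  by (simp add: word_prod_def)

lemma word_prod_append: "word_prod n (xs @ ys) = word_prod n xs \<circ> word_prod n ys"
  by (induction xs) (auto simp: o_assoc)

lemma cox_gen_cong:
  assumes "i mod int n = j mod int n"
  shows "cox_gen n i = cox_gen n j"
proof -
  have "(i + 1) mod int n = (j + 1) mod int n" using assms by (metis mod_add_left_eq)
  then show ?thesis using assms by (simp add: cox_gen_def fun_eq_iff)
qed

text \<open>The element \<open>(r, d)\<close> stands for the pair of positions \<open>(r, r + d)\<close> up to simultaneous shifts
  by \<open>n\<close>.\<close>

definition inversions :: "nat \<Rightarrow> (int \<Rightarrow> int) \<Rightarrow> (int \<times> int) set" where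
  "inversions n w = {(r, d). 0 \<le> r \<and> r < int n \<and> 0 < d \<and> w (r + d) < w r}"

text \<open>For \<open>a \<le> b\<close>, the coordinate at \<open>k\<close> is the number of \<open>t \<in> {a..<b}\<close> congruent to \<open>k\<close>.\<close>

definition real_root :: "nat \<Rightarrow> int \<Rightarrow> int \<Rightarrow> int \<Rightarrow> real" where
  "real_root n a b k =
     (if k \<in> {1..int n} then real_of_int ((b - k - 1) div int n - (a - k - 1) div int n) else 0)"

lemma real_root_add: "real_root n a b k + real_root n b c k = real_root n a c k"
  by (simp add: real_root_def)

lemma real_root_add_fun: "(\<lambda>k. real_root n a b k + real_root n b c k) = real_root n a c"
  by (simp add: real_root_add fun_eq_iff)

lemma real_root_uminus: "real_root n b a = (\<lambda>k. - real_root n a b k)"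
  by (simp add: real_root_def fun_eq_iff)

lemma root_pair_add: "root_pair n (\<lambda>k. u k + v k) f = root_pair n u f + root_pair n v f"
  by (simp add: root_pair_def distrib_right sum.distrib)

lemma simple_refl_uminus: "simple_refl n i (\<lambda>k. - v k) = (\<lambda>k. - simple_refl n i v k)"
  by (simp add: simple_refl_def fun_eq_iff sum_negf)

context
  fixes n :: nat
  assumes n: "n \<ge> 3"
begin

section \<open>The generators and membership in the group\<close>

lemma n_pos: "int n > 0"
  using n by simp

lemma mod_add_right_cancel: "(a + c) mod int n = (b + c) mod int n \<longleftrightarrow> a mod int n = b mod int n"
  by (simp add: mod_eq_dvd_iff)

lemma mod_add_small_neq:
  assumes "c = 1 \<or> c = 2"
  shows "(a + c) mod int n \<noteq> a mod int n"
proof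
  assume "(a + c) mod int n = a mod int n"
  then have "int n dvd c" by (simp add: mod_eq_dvd_iff)
  then show False using assms n by (auto dest: zdvd_imp_le)
qed

lemma cox_gen_involution [simp]: "cox_gen n i (cox_gen n i t) = t"
  using mod_add_right_cancel[of t 1 i] mod_add_right_cancel[of "t - 1" 1 i] mod_add_small_neq[of 1 i]
  by (auto simp: cox_gen_def)

lemma cox_gen_self: "cox_gen n i i = i + 1" "cox_gen n i (i + 1) = i"
  using mod_add_small_neq[of 1 i] by (auto simp: cox_gen_def)

lemma bij_cox_gen: "bij (cox_gen n i)"
  by (rule o_bij[where g = "cox_gen n i"]) auto

text \<open>Every integer moves by at most 1, so a reversed pair has distance at most 2, and the
  residues leave only the shifts of \<open>(i, i + 1)\<close>.\<close>

lemma cox_gen_less: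
  assumes "a < b"
  shows "cox_gen n i a < cox_gen n i b \<or> a mod int n = i mod int n \<and> b = a + 1"
proof (rule ccontr)
  assume *: "\<not> ?thesis"
  have "cox_gen n i a \<noteq> cox_gen n i b" using assms by (metis cox_gen_involution less_irrefl)
  then have less: "cox_gen n i b < cox_gen n i a" using * by simp
  have "b = a + 1 \<or> b = a + 2"
    using less assms by (auto simp: cox_gen_def split: if_splits)
  then show False
  proof
    assume "b = a + 1"
    then show False using less * mod_add_right_cancel[of a 1 i]
      by (auto simp: cox_gen_def split: if_splits)
  next
    assume b: "b = a + 2"
    then have "a mod int n = i mod int n" "(a + 1 + 1) mod int n = (i + 1) mod int n"
      using less b by (auto simp: cox_gen_def split: if_splits)
    then show False using mod_add_right_cancel mod_add_small_neq[of 1 a] by metis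
  qed
qed

lemma affine_weyl_shift:
  assumes "w \<in> affine_weyl n"
  shows "w (t + k * int n) = w t + k * int n"
  using quasi_periodic_shift[of w "int n" "int n" t k] assms by (simp add: affine_weyl_def)

lemma affine_weyl_bij: "w \<in> affine_weyl n \<Longrightarrow> bij w"
  by (simp add: affine_weyl_def)

lemma affine_weyl_eq_iff: "w \<in> affine_weyl n \<Longrightarrow> w a = w b \<longleftrightarrow> a = b"
  using affine_weyl_bij bij_is_inj inj_eq by metis

text \<open>The displacement \<open>w t - t\<close> is periodic, so the normalization of the sum can
  be tested on any window; later proofs choose \<open>x\<close> to fit the situation.\<close>

lemma affine_weyl_iff:
  "w \<in> affine_weyl n \<longleftrightarrow> bij w \<and> (\<forall>i. w (i + int n) = w i + int n) \<and> (\<Sum>t = x..<x + int n. w t - t) = 0"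
proof -
  have "(\<Sum>t = x..<x + int n. w t - t) = (\<Sum>t = 1..int n. w t) - (\<Sum>t = 1..int n. t)"
    if "\<forall>i. w (i + int n) = w i + int n"
  proof -
    have "{1..int n} = {1..<1 + int n}" by auto
    then show ?thesis
      using sum_periodic_window[OF n_pos, of "\<lambda>t. w t - t" x 1] that by (simp add: sum_subtractf)
  qed
  then show ?thesis unfolding affine_weyl_def by auto
qed

lemma affine_weyl_mod_eq_iff:
  assumes "w \<in> affine_weyl n"
  shows "w a mod int n = w b mod int n \<longleftrightarrow> a mod int n = b mod int n"
proof
  assume "w a mod int n = w b mod int n"
  then obtain k where "w b = w a + k * int n" by (rule eq_add_mult_if_mod_eq)
  then have "w b = w (a + k * int n)" using affine_weyl_shift[OF assms] by simp
  then have "b = a + k * int n" using affine_weyl_eq_iff[OF assms] by simp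
  then show "a mod int n = b mod int n" by simp
next
  assume "a mod int n = b mod int n"
  then obtain k where "b = a + k * int n" by (rule eq_add_mult_if_mod_eq)
  then show "w a mod int n = w b mod int n" using affine_weyl_shift[OF assms] by simp
qed

lemma inversion_not_congruent:
  assumes "w \<in> affine_weyl n" and "a < b" and "w b < w a"
  shows "a mod int n \<noteq> b mod int n"
proof
  assume "a mod int n = b mod int n"
  then obtain k where "b = a + k * int n" by (rule eq_add_mult_if_mod_eq)
  then show False using affine_weyl_shift[OF assms(1), of a k] assms(2,3) by simp
qed

lemma affine_weyl_comp_cox_gen:
  assumes "w \<in> affine_weyl n"
  shows "w \<circ> cox_gen n i \<in> affine_weyl n"
proof -
  let ?s = "cox_gen n i" and ?W = "{i..<i + int n}"
  \<comment> \<open>The window starting at \<open>i\<close> meets the swapped pairs only in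
    \<open>(i, i + 1)\<close>, so the generator permutes the window.\<close>
  have m: "t mod int n = i mod int n \<longleftrightarrow> t = i" "t mod int n = (i + 1) mod int n \<longleftrightarrow> t = i + 1"
    if "t \<in> ?W" for t
    using that n mod_eq_near[OF n_pos, of t i] mod_eq_near[OF n_pos, of t "i + 1"] by auto
  have sW: "?s t \<in> ?W" if "t \<in> ?W" for t
    using that m[OF that] n by (auto simp: cox_gen_def)
  have "(\<Sum>t\<in>?W. w (?s t)) = (\<Sum>t\<in>?W. w t)"
    by (rule sum.reindex_bij_witness[of _ ?s ?s]) (use sW in auto)
  moreover have "bij (w \<circ> ?s)" using affine_weyl_bij[OF assms] bij_cox_gen by (rule bij_comp[rotated])
  ultimately show ?thesis
    using assms unfolding affine_weyl_iff[of _ i] by (simp add: sum_subtractf cox_gen_periodic)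
qed

lemma affine_weyl_comp_cox_gen_cancel: "w \<circ> cox_gen n i \<circ> cox_gen n i = w"
  by (simp add: fun_eq_iff)

lemma id_affine_weyl: "id \<in> affine_weyl n"
  by (simp add: affine_weyl_def)

lemma word_prod_affine_weyl: "word_prod n ks \<in> affine_weyl n"
proof (induction ks rule: rev_induct)
  case (snoc k ks)
  then show ?case using affine_weyl_comp_cox_gen[OF snoc] by (simp add: word_prod_append o_def)
qed (use id_affine_weyl in \<open>simp add: id_def\<close>)

subsection \<open>Crossings\<close>

text \<open>If \<open>w\<close> maps a window of length \<open>n\<close> to one side of an endpoint, it permutes the window:
  replacing each value by its representative in the window moves all values in the same direction,
  but does not change their sum.\<close>

lemma window_stable:
  assumes w: "w \<in> affine_weyl n"
    and side: "(\<forall>t\<in>{x..<x + int n}. x \<le> w t) \<or> (\<forall>t\<in>{x..<x + int n}. w t < x + int n)"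
    and t: "t \<in> {x..<x + int n}"
  shows "w t \<in> {x..<x + int n}"
proof -
  let ?W = "{x..<x + int n}"
  define r where "r y = x + (y - x) mod int n" for y
  have rW: "r y \<in> ?W" for y
    using n_pos by (simp add: r_def)
  have r_mod: "r y mod int n = y mod int n" for y
    by (simp add: r_def mod_add_right_eq)
  have inj: "inj_on (\<lambda>t. r (w t)) ?W"
  proof
    fix a b assume ab: "a \<in> ?W" "b \<in> ?W" "r (w a) = r (w b)"
    then have "w a mod int n = w b mod int n" using r_mod by metis
    then have "a mod int n = b mod int n" using affine_weyl_mod_eq_iff[OF w] by simp
    then show "a = b" using ab mod_eq_near[OF n_pos, of a b] by auto
  qed
  have "(\<lambda>t. r (w t)) ` ?W = ?W"
    by (rule endo_inj_surj) (use inj rW in auto)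
  then have "(\<Sum>t\<in>?W. r (w t)) = (\<Sum>t\<in>?W. t)"
    using inj sum.reindex[of "\<lambda>t. r (w t)" ?W "\<lambda>t. t"] by simp
  moreover have "(\<Sum>t\<in>?W. w t) = (\<Sum>t\<in>?W. t)"
    using w affine_weyl_iff[of w x] by (simp add: sum_subtractf)
  ultimately have sum0: "(\<Sum>t\<in>?W. w t - r (w t)) = 0" "(\<Sum>t\<in>?W. r (w t) - w t) = 0"
    by (simp_all add: sum_subtractf)
  have "w t = r (w t)"
    using side
  proof
    assume *: "\<forall>t\<in>?W. x \<le> w t"
    have "0 \<le> w t - r (w t)" if "t \<in> ?W" for t
      using * that n_pos zmod_le_nonneg_dividend[of "w t - x" "int n"] by (simp add: r_def)
    then have "\<forall>t\<in>?W. w t - r (w t) = 0"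
      using sum_nonneg_eq_0_iff[of ?W "\<lambda>t. w t - r (w t)"] sum0 by auto
    then show ?thesis using t by simp
  next
    assume *: "\<forall>t\<in>?W. w t < x + int n"
    have "0 \<le> r (w t) - w t" if "t \<in> ?W" for t
    proof -
      obtain k where k: "r (w t) = w t + k * int n"
        using eq_add_mult_if_mod_eq[of "w t" "int n" "r (w t)"] r_mod by metis
      \<comment> \<open>The representative is at least \<open>x\<close> and the value lies below
        \<open>x + n\<close>, so they differ by more than \<open>- n\<close>.\<close>
      have "(- 1) * int n < k * int n" using k rW[of "w t"] * that by fastforce
      then have "k > -1" by (simp only: mult_less_cancel_right_pos[OF n_pos])
      then show ?thesis using k by simp
    qed
    then have "\<forall>t\<in>?W. r (w t) - w t = 0"
      using sum_nonneg_eq_0_iff[of ?W "\<lambda>t. r (w t) - w t"] sum0 by auto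
    then show ?thesis using t by simp
  qed
  then show ?thesis using rW by metis
qed

lemma window_representative:
  obtains t k where "y = t + k * int n" and "t \<in> {x..<x + int n}"
proof -
  let ?t = "x + (y - x) mod int n"
  have "?t mod int n = y mod int n" by (simp add: mod_add_right_eq)
  then obtain k where "y = ?t + k * int n" by (rule eq_add_mult_if_mod_eq)
  then show ?thesis using that[of ?t k] n_pos by simp
qed

text \<open>Otherwise positions left of \<open>x\<close> keep values left of \<open>x\<close>, and
  \<open>w\<close> permutes the window that ends just before \<open>x\<close>. Then it permutes
  every shift of that window, and \<open>b\<close>, which lies in a later one, cannot be sent below
  \<open>x\<close>.\<close>

lemma crossing_down_imp_up:
  assumes w: "w \<in> affine_weyl n" and "x \<le> b" and "w b < x"
  shows "\<exists>t<x. x \<le> w t"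
proof (rule ccontr)
  assume "\<not> ?thesis"
  then have "\<forall>t\<in>{x - int n..<x - int n + int n}. w t < x - int n + int n" by auto
  note stable = window_stable[OF w disjI2[OF this]]
  obtain t k where tk: "b = t + k * int n" "t \<in> {x - int n..<x - int n + int n}"
    using window_representative .
  have "0 * int n < k * int n" using tk assms(2) by auto
  then have "k > 0" by (simp only: mult_less_cancel_right_pos[OF n_pos])
  then have "k * int n \<ge> int n" using n_pos by (simp add: mult_le_cancel_right1)
  moreover have "w b = w t + k * int n" using affine_weyl_shift[OF w] tk by simp
  ultimately show False using stable[OF tk(2)] assms(3) by simp
qed

text \<open>The mirror image, with the window that starts at \<open>x\<close> and an earlier shift
  of it that contains \<open>a\<close>.\<close>

lemma crossing_up_imp_down:
  assumes w: "w \<in> affine_weyl n" and "a < x" and "x \<le> w a"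
  shows "\<exists>t\<ge>x. w t < x"
proof (rule ccontr)
  assume "\<not> ?thesis"
  then have "\<forall>t\<in>{x..<x + int n}. x \<le> w t" by (auto simp: not_less)
  note stable = window_stable[OF w disjI1[OF this]]
  obtain t k where tk: "a = t + k * int n" "t \<in> {x..<x + int n}"
    using window_representative .
  have "k * int n < 0 * int n" using tk assms(2) by auto
  then have "k < 0" by (simp only: mult_less_cancel_right_pos[OF n_pos])
  then have "k * int n \<le> -1 * int n" using n_pos by (intro mult_right_mono) auto
  moreover have "w a = w t + k * int n" using affine_weyl_shift[OF w] tk by simp
  ultimately show False using stable[OF tk(2)] assms(3) by simp
qed

text \<open>If an inversion \<open>(a, b)\<close> has \<open>w a \<le> a\<close>, then
  \<open>b\<close> moves down across \<open>a\<close>; a value moving up across \<open>a\<close>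
  comes from some \<open>c < a\<close> and completes a pattern \<open>c, a, b\<close>. The case
  \<open>w b \<ge> b\<close> is dual. Conversely, the middle entry of a pattern would have to move
  both down and up.\<close>

lemma avoids_321_iff:
  assumes w: "w \<in> affine_weyl n"
  shows "avoids_321 w \<longleftrightarrow> (\<forall>a b. a < b \<and> w a > w b \<longrightarrow> w a > a \<and> w b < b)"
proof
  assume av: "avoids_321 w"
  show "\<forall>a b. a < b \<and> w a > w b \<longrightarrow> w a > a \<and> w b < b"
  proof (intro allI impI)
    fix a b assume ab: "a < b \<and> w a > w b"
    have "w a > a"
    proof (rule ccontr)
      assume "\<not> w a > a"
      then obtain c where c: "c < a" "a \<le> w c"
        using crossing_down_imp_up[OF w, of a b] ab by auto
      then have "w c \<noteq> w a" using affine_weyl_eq_iff[OF w] by simp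
      then have "w a < w c" using c \<open>\<not> w a > a\<close> by simp
      then show False using av ab c(1) unfolding avoids_321_def by blast
    qed
    moreover have "w b < b"
    proof (rule ccontr)
      assume "\<not> w b < b"
      \<comment> \<open>The threshold is \<open>b + 1\<close> because the new position must lie
        strictly to the right of \<open>b\<close>.\<close>
      then obtain c where c: "c \<ge> b + 1" "w c < b + 1"
        using crossing_up_imp_down[OF w, of a "b + 1"] ab by auto
      then have "w c \<noteq> w b" using affine_weyl_eq_iff[OF w] by simp
      then have "w c < w b" "b < c" using c \<open>\<not> w b < b\<close> by simp_all
      then show False using av ab unfolding avoids_321_def by blast
    qed
    ultimately show "w a > a \<and> w b < b" ..
  qed
next
  assume "\<forall>a b. a < b \<and> w a > w b \<longrightarrow> w a > a \<and> w b < b"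
  then show "avoids_321 w" unfolding avoids_321_def by (meson less_asym)
qed

subsection \<open>Inversions and reduced words\<close>

text \<open>By periodicity the displacements are bounded by some \<open>M\<close>, and two positions
  more than \<open>2 * M\<close> apart cannot change their order.\<close>

lemma finite_inversions:
  assumes w: "w \<in> affine_weyl n"
  shows "finite (inversions n w)"
proof -
  define M where "M = Max ((\<lambda>t. \<bar>w t - t\<bar>) ` {0..<int n})"
  have M: "\<bar>w y - y\<bar> \<le> M" for y
  proof -
    obtain t k where tk: "y = t + k * int n" "t \<in> {0..<0 + int n}"
      using window_representative .
    then have "w y - y = w t - t" using affine_weyl_shift[OF w] by simp
    then show ?thesis unfolding M_def using tk(2) by (simp add: Max_ge)
  qed
  have "inversions n w \<subseteq> {0..<int n} \<times> {0..2 * M}"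
  proof (clarsimp simp: inversions_def)
    fix r d assume "w (r + d) < w r"
    then show "d \<le> 2 * M" using M[of r] M[of "r + d"] by linarith
  qed
  then show ?thesis by (rule finite_subset) simp
qed

text \<open>The generator \<open>s\<^sub>i\<close> permutes the pairs \<open>(a, b)\<close>, up to simultaneous shifts, and preserves the
  order in each pair except in the shifts of \<open>(i, i + 1)\<close>.\<close>

lemma card_inversions_descent:
  assumes w: "w \<in> affine_weyl n" and desc: "w (i + 1) < w i"
  shows "card (inversions n w) = Suc (card (inversions n (w \<circ> cox_gen n i)))"
proof -
  let ?s = "cox_gen n i" and ?w' = "w \<circ> cox_gen n i"
  let ?p = "(i mod int n, 1::int)"
  \<comment> \<open>Applies \<open>s\<^sub>i\<close> to both entries of a pair and shifts the pair
    back to a first entry in \<open>{0..<n}\<close>.\<close>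
  define \<phi> where "\<phi> = (\<lambda>(r, d). (?s r mod int n, ?s (r + d) - ?s r))"
  have w': "?w' \<in> affine_weyl n" using affine_weyl_comp_cox_gen[OF w] .
  have s_shift: "?s (t + k * int n) = ?s t + k * int n" for t k
    using quasi_periodic_shift[of ?s "int n" "int n" t k] cox_gen_periodic by simp
  have red: "\<exists>k. x mod int n = x + k * int n" for x
    by (rule eq_add_mult_if_mod_eq[of x "int n" "x mod int n"]) auto
  have \<phi>\<phi>: "\<phi> (\<phi> (r, d)) = (r, d)" if "0 \<le> r" "r < int n" for r d
  proof -
    obtain k where k: "?s r mod int n = ?s r + k * int n" using red by blast
    have "?s (?s r mod int n) = r + k * int n" unfolding k s_shift by simp
    moreover have "?s (?s r mod int n + (?s (r + d) - ?s r)) = r + d + k * int n"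
    proof -
      have eq: "?s r mod int n + (?s (r + d) - ?s r) = ?s (r + d) + k * int n" using k by simp
      show ?thesis unfolding eq s_shift by simp
    qed
    ultimately show ?thesis using that by (simp add: \<phi>_def)
  qed
  \<comment> \<open>Stated for an arbitrary \<open>v\<close>, so that it serves for \<open>w\<close>
    and for \<open>w \<circ> s\<^sub>i\<close> and gives both inclusions.\<close>
  have \<phi>_in: "\<phi> (r, d) \<in> inversions n (v \<circ> ?s) - {?p}"
    if v: "v \<in> affine_weyl n" and rd: "(r, d) \<in> inversions n v - {?p}" for v r d
  proof -
    obtain k where k: "?s r mod int n = ?s r + k * int n" using red by blast
    have r: "0 \<le> r" "r < int n" "d > 0" "v (r + d) < v r" "r = i mod int n \<longrightarrow> d \<noteq> 1"
      using rd by (auto simp: inversions_def)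
    have less: "?s r < ?s (r + d)" using cox_gen_less[of r "r + d" i] r by auto
    have "v (?s (?s r mod int n + (?s (r + d) - ?s r))) < v (?s (?s r mod int n))"
    proof -
      have "?s (?s r mod int n) = r + k * int n" unfolding k s_shift by simp
      moreover have eq: "?s r mod int n + (?s (r + d) - ?s r) = ?s (r + d) + k * int n" using k by simp
      have "?s (?s r mod int n + (?s (r + d) - ?s r)) = r + d + k * int n"
        unfolding eq s_shift by simp
      ultimately show ?thesis using r affine_weyl_shift[OF v] by simp
    qed
    then have "\<phi> (r, d) \<in> inversions n (v \<circ> ?s)"
      using less n_pos by (simp add: \<phi>_def inversions_def)
    moreover have "\<phi> (r, d) \<noteq> ?p"
    proof
      assume "\<phi> (r, d) = ?p"
      then have eq: "?s r mod int n = i mod int n" "?s (r + d) = ?s r + 1" by (auto simp: \<phi>_def)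
      then have "?s (?s r) = ?s r + 1" by (simp add: cox_gen_def)
      moreover have "?s (?s r + 1) = ?s r"
        using eq(1) mod_add_right_cancel[of "?s r" 1 i] mod_add_small_neq[of 1 i]
        by (simp add: cox_gen_def)
      moreover have "r + d = ?s (?s (r + d))" by simp
      \<comment> \<open>Only the reversed pair is sent to \<open>?p\<close>, and its second entry
        precedes its first.\<close>
      ultimately have "r = ?s r + 1" "r + d = ?s r" using eq(2) by simp_all
      then show False using r(3) by simp
    qed
    ultimately show ?thesis by blast
  qed
  have "bij_betw \<phi> (inversions n w - {?p}) (inversions n ?w' - {?p})"
  proof (rule bij_betw_byWitness[where f' = \<phi>])
    show "\<phi> ` (inversions n ?w' - {?p}) \<subseteq> inversions n w - {?p}"
      using \<phi>_in[OF w'] unfolding affine_weyl_comp_cox_gen_cancel by (intro image_subsetI) fast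
    show "\<phi> ` (inversions n w - {?p}) \<subseteq> inversions n ?w' - {?p}"
      using \<phi>_in[OF w] by (intro image_subsetI) fast
  qed (auto simp: inversions_def \<phi>\<phi>)
  then have card: "card (inversions n w - {?p}) = card (inversions n ?w' - {?p})"
    by (rule bij_betw_same_card)
  obtain k where k: "i mod int n = i + k * int n" using red by blast
  have "w (i mod int n + 1) = w (i + 1) + k * int n" "w (i mod int n) = w i + k * int n"
    using affine_weyl_shift[OF w, of "i + 1" k] affine_weyl_shift[OF w, of i k] k
    by (simp_all add: algebra_simps)
  moreover have "?w' (i mod int n + 1) = ?w' (i + 1) + k * int n" "?w' (i mod int n) = ?w' i + k * int n"
    using affine_weyl_shift[OF w', of "i + 1" k] affine_weyl_shift[OF w', of i k] k
    by (simp_all add: algebra_simps)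
  ultimately have "?p \<in> inversions n w" "?p \<notin> inversions n ?w'"
    using desc n_pos by (simp_all add: inversions_def cox_gen_self)
  then show ?thesis
    using card card.remove[OF finite_inversions[OF w], of ?p] by (simp del: card_Diff_insert)
qed

lemma ascent_or_descent:
  assumes "w \<in> affine_weyl n"
  shows "w i < w (i + 1) \<or> w (i + 1) < w i"
  using affine_weyl_eq_iff[OF assms, of i "i + 1"] by linarith

text \<open>An ascent of \<open>w\<close> at \<open>i\<close> is a descent of
  \<open>w \<circ> s\<^sub>i\<close>, and the generator is an involution.\<close>

lemma card_inversions_ascent:
  assumes w: "w \<in> affine_weyl n" and asc: "w i < w (i + 1)"
  shows "card (inversions n (w \<circ> cox_gen n i)) = Suc (card (inversions n w))"
  using card_inversions_descent[OF affine_weyl_comp_cox_gen[OF w], of i i] asc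
  by (simp add: cox_gen_self affine_weyl_comp_cox_gen_cancel)

lemma card_inversions_word_prod_le: "card (inversions n (word_prod n ks)) \<le> length ks"
proof (induction ks rule: rev_induct)
  case Nil
  have "inversions n id = {}" by (auto simp: inversions_def)
  then show ?case by (simp add: id_def)
next
  case (snoc k ks)
  have eq: "word_prod n (ks @ [k]) = word_prod n ks \<circ> cox_gen n k" by (simp add: word_prod_append)
  have "card (inversions n (word_prod n ks \<circ> cox_gen n k)) \<le> Suc (length ks)"
    using ascent_or_descent[OF word_prod_affine_weyl, of ks k]
  proof
    assume "word_prod n ks k < word_prod n ks (k + 1)"
    from card_inversions_ascent[OF word_prod_affine_weyl this] snoc show ?thesis by linarith
  next
    assume "word_prod n ks (k + 1) < word_prod n ks k"
    from card_inversions_descent[OF word_prod_affine_weyl this] snoc show ?thesis by linarith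
  qed
  then show ?case unfolding eq by (simp only: length_append_singleton)
qed

text \<open>An increasing bijection of the integers skips no value, so it is a translation; the sum
  condition makes the translation trivial.\<close>

lemma affine_weyl_eq_id_if_no_descent:
  assumes w: "w \<in> affine_weyl n" and asc: "\<And>i. w i < w (i + 1)"
  shows "w = id"
proof -
  have step: "w (i + 1) = w i + 1" for i
  proof -
    obtain c where c: "w c = w i + 1" using affine_weyl_bij[OF w] by (metis bij_pointE)
    have mono: "w a < w b" if "a < b" for a b
      using that
    proof (induction b rule: int_gr_induct)
      case base
      show ?case using asc[of a] .
    next
      case (step b)
      then show ?case using asc[of b] by simp
    qed
    have "\<not> c < i" using c mono[of c i] by auto
    moreover have "c \<noteq> i" using c by auto
    moreover have "\<not> i + 1 < c" using c mono[of "i + 1" c] asc[of i] by auto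
    ultimately have "c = i + 1" by linarith
    then show ?thesis using c by simp
  qed
  have w0: "w i = w 0 + i" for i
    using quasi_periodic_shift[of w 1 1 0 i] step by simp
  have "(\<Sum>t = 0..<int n. w t - t) = 0" using w affine_weyl_iff[of w 0] by simp
  moreover have "w t - t = w 0" for t using w0[of t] by simp
  ultimately have "w 0 = 0" using n by simp
  then have "w i = i" for i using w0[of i] by simp
  then show ?thesis by auto
qed

text \<open>Descents occur at arbitrary integers, whereas the letters of an expression are confined
  to \<open>{1..n}\<close>.\<close>

lemma generator_representative:
  obtains k where "k \<in> {1..int n}" and "cox_gen n k = cox_gen n i" and "k mod int n = i mod int n"
proof -
  obtain t k where tk: "i = t + k * int n" "t \<in> {1..<1 + int n}"
    using window_representative .
  then have "t mod int n = i mod int n" by simp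
  then show ?thesis using that[OF _ cox_gen_cong, of t] tk(2) by simp
qed

lemma expression_snoc:
  assumes "expression n ks (w \<circ> cox_gen n i)" and "k \<in> {1..int n}" and "cox_gen n k = cox_gen n i"
  shows "expression n (ks @ [k]) w"
  using assms affine_weyl_comp_cox_gen_cancel[of w i] by (simp add: expression_def word_prod_append)

text \<open>Sorting: as long as there is a descent, removing its generator lowers the number of
  inversions by one.\<close>

lemma exists_expression:
  assumes "w \<in> affine_weyl n"
  shows "\<exists>ks. expression n ks w \<and> length ks = card (inversions n w)"
  using assms
proof (induction "card (inversions n w)" arbitrary: w rule: less_induct)
  case less
  show ?case
  proof (cases "\<exists>i. w (i + 1) < w i")
    case True
    then obtain i where i: "w (i + 1) < w i" by blast
    note card = card_inversions_descent[OF less.prems i]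
    then obtain ks where ks: "expression n ks (w \<circ> cox_gen n i)"
        "length ks = card (inversions n (w \<circ> cox_gen n i))"
      using less.hyps[OF _ affine_weyl_comp_cox_gen[OF less.prems]] by (metis lessI)
    obtain k where k: "k \<in> {1..int n}" "cox_gen n k = cox_gen n i"
      using generator_representative .
    show ?thesis using expression_snoc[OF ks(1) k] ks(2) card by (intro exI[of _ "ks @ [k]"]) simp
  next
    case False
    then have "w = id"
      using affine_weyl_eq_id_if_no_descent[OF less.prems] ascent_or_descent[OF less.prems] by blast
    moreover have "inversions n id = {}" by (auto simp: inversions_def)
    ultimately show ?thesis by (intro exI[of _ "[]"]) (simp add: expression_def id_def)
  qed
qed

lemma reduced_expression_iff:
  assumes "w \<in> affine_weyl n"
  shows "reduced_expression n ks w \<longleftrightarrow> expression n ks w \<and> length ks = card (inversions n w)"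
proof -
  obtain js where js: "expression n js w" "length js = card (inversions n w)"
    using exists_expression[OF assms] by blast
  have le: "card (inversions n w) \<le> length js" if "expression n js w" for js
    using that card_inversions_word_prod_le[of js] by (auto simp: expression_def)
  show ?thesis
  proof
    assume *: "reduced_expression n ks w"
    then have "expression n ks w" "length ks \<le> length js"
      using js(1) unfolding reduced_expression_def by blast+
    then show "expression n ks w \<and> length ks = card (inversions n w)"
      using js(2) le by force
  next
    assume "expression n ks w \<and> length ks = card (inversions n w)"
    then show "reduced_expression n ks w" using le unfolding reduced_expression_def by simp
  qed
qed

text \<open>At a descent, the letter \<open>k\<close> would shorten the prefix; a shorter word for
  the prefix together with \<open>k\<close>, followed by \<open>ys\<close>, would then contradict
  minimality.\<close>

lemma reduced_expression_ascent:
  assumes "reduced_expression n (xs @ [k] @ ys) w"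
  shows "word_prod n xs k < word_prod n xs (k + 1)"
proof (rule ccontr)
  let ?x = "word_prod n xs"
  assume "\<not> ?thesis"
  then have "?x (k + 1) < ?x k"
    using ascent_or_descent[OF word_prod_affine_weyl] by blast
  then have "card (inversions n ?x) = Suc (card (inversions n (?x \<circ> cox_gen n k)))"
    using card_inversions_descent[OF word_prod_affine_weyl] by blast
  moreover obtain js where js: "expression n js (?x \<circ> cox_gen n k)"
      "length js = card (inversions n (?x \<circ> cox_gen n k))"
    using exists_expression[OF affine_weyl_comp_cox_gen[OF word_prod_affine_weyl]] by blast
  ultimately have "length js < length xs" using card_inversions_word_prod_le[of xs] by simp
  moreover have "expression n (js @ ys) w"
    using js(1) assms unfolding reduced_expression_def expression_def
    by (simp add: word_prod_append fun_eq_iff)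
  then have "length (xs @ [k] @ ys) \<le> length (js @ ys)"
    using assms unfolding reduced_expression_def by blast
  ultimately show False by simp
qed

section \<open>Persistence of descending triples\<close>

lemma descending_triple_comp_cox_gen:
  assumes "a < b" and "b < c" and "w b < w a" and "w c < w b"
    and "\<not> (b = a + 1 \<and> a mod int n = i mod int n)" and "\<not> (c = b + 1 \<and> b mod int n = i mod int n)"
  shows "cox_gen n i a < cox_gen n i b \<and> cox_gen n i b < cox_gen n i c \<and>
    (w \<circ> cox_gen n i) (cox_gen n i b) < (w \<circ> cox_gen n i) (cox_gen n i a) \<and>
    (w \<circ> cox_gen n i) (cox_gen n i c) < (w \<circ> cox_gen n i) (cox_gen n i b)"
  using assms cox_gen_less[of a b i] cox_gen_less[of b c i] by auto

lemma descent_shift: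
  assumes "w \<in> affine_weyl n" and "a mod int n = i mod int n"
  shows "w (a + 1) < w a \<longleftrightarrow> w (i + 1) < w i"
proof -
  obtain k where k: "i = a + k * int n" using assms(2) by (rule eq_add_mult_if_mod_eq)
  then have "w (i + 1) = w (a + 1) + k * int n" "w i = w a + k * int n"
    using affine_weyl_shift[OF assms(1), of "a + 1" k] affine_weyl_shift[OF assms(1), of a k]
    by (simp_all add: algebra_simps)
  then show ?thesis by simp
qed

text \<open>A letter of a reduced word is appended at an ascent, so it never swaps two neighbouring
  positions that form an inversion. The triple survives with its positions moved by the
  generator.\<close>

lemma not_avoids_321_word_prod_append:
  assumes "reduced_expression n (xs @ ys) w" and "\<not> avoids_321 (word_prod n xs)"
  shows "\<not> avoids_321 w"
  using assms
proof (induction ys arbitrary: xs)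
  case Nil
  then have "expression n xs w" unfolding reduced_expression_def by simp
  then show ?case using Nil.prems(2) by (simp add: expression_def)
next
  case (Cons k ys)
  let ?x = "word_prod n xs"
  obtain a b c where abc: "a < b" "b < c" "?x b < ?x a" "?x c < ?x b"
    using Cons.prems(2) unfolding avoids_321_def by blast
  have "\<not> ?x (k + 1) < ?x k"
    using reduced_expression_ascent[of xs k ys w] Cons.prems(1) by simp
  then have no: "\<not> (y = x + 1 \<and> x mod int n = k mod int n)" if "?x y < ?x x" for x y
    using descent_shift[OF word_prod_affine_weyl, of x k xs] that by auto
  have "\<not> avoids_321 (?x \<circ> cox_gen n k)"
    using descending_triple_comp_cox_gen[OF abc no[OF abc(3)] no[OF abc(4)]]
    unfolding avoids_321_def by blast
  then have "\<not> avoids_321 (word_prod n (xs @ [k]))" by (simp add: word_prod_append)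
  then show ?case using Cons.IH[of "xs @ [k]"] Cons.prems(1) by simp
qed

subsection \<open>Full commutativity\<close>

text \<open>As \<open>n \<ge> 3\<close>, the residues of \<open>i\<close>, \<open>i + 1\<close>,
  \<open>i + 2\<close> are distinct, so two adjacent generators act on these positions like adjacent
  transpositions of three letters.\<close>

lemma cox_gen_neighbours:
  "cox_gen n (i + 1) i = i" "cox_gen n i (i + 2) = i + 2"
  "cox_gen n (i + 1) (i + 1) = i + 2" "cox_gen n (i + 1) (i + 2) = i + 1"
proof -
  have ne: "i mod int n \<noteq> (i + 1) mod int n" "i mod int n \<noteq> (i + 2) mod int n"
       "(i + 1) mod int n \<noteq> (i + 2) mod int n"
    using mod_add_small_neq[of 1 i, OF disjI1] mod_add_small_neq[of 2 i, OF disjI2]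
      mod_add_small_neq[of 1 "i + 1", OF disjI1] unfolding add.assoc one_add_one by metis+
  have "cox_gen n (i + 1) t = (if t mod int n = (i + 1) mod int n then t + 1
      else if t mod int n = (i + 2) mod int n then t - 1 else t)" for t
    unfolding cox_gen_def add.assoc one_add_one ..
  with ne show "cox_gen n (i + 1) i = i" "cox_gen n (i + 1) (i + 1) = i + 2"
      "cox_gen n (i + 1) (i + 2) = i + 1"
    by simp_all
  show "cox_gen n i (i + 2) = i + 2"
    unfolding cox_gen_def if_not_P[OF ne(2)[symmetric]] if_not_P[OF ne(3)[symmetric]] ..
qed

lemma reduced_expression_snoc:
  assumes w: "w \<in> affine_weyl n" and desc: "w (i + 1) < w i"
    and ks: "reduced_expression n ks (w \<circ> cox_gen n i)"
    and k: "k \<in> {1..int n}" "cox_gen n k = cox_gen n i"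
  shows "reduced_expression n (ks @ [k]) w"
proof -
  have *: "expression n ks (w \<circ> cox_gen n i)" "length ks = card (inversions n (w \<circ> cox_gen n i))"
    using ks reduced_expression_iff[OF affine_weyl_comp_cox_gen[OF w]] by blast+
  then have "length (ks @ [k]) = card (inversions n w)"
    using card_inversions_descent[OF w desc] by (simp only: length_append_singleton)
  then show ?thesis using expression_snoc[OF *(1) k] reduced_expression_iff[OF w] by blast
qed

text \<open>Appending the generator of a descent keeps a word reduced and keeps the factor in
  it.\<close>

lemma not_fully_commutative_descent:
  assumes w: "w \<in> affine_weyl n" and desc: "w (i + 1) < w i"
    and nfc: "\<not> fully_commutative n (w \<circ> cox_gen n i)"
  shows "\<not> fully_commutative n w"
proof -
  obtain xs p q ys where red: "reduced_expression n (xs @ [p, q, p] @ ys) (w \<circ> cox_gen n i)"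
    using nfc unfolding fully_commutative_def by blast
  obtain k where "k \<in> {1..int n}" "cox_gen n k = cox_gen n i"
    using generator_representative .
  from reduced_expression_snoc[OF w desc red this]
  have "reduced_expression n (xs @ [p, q, p] @ (ys @ [k])) w" by simp
  then show ?thesis unfolding fully_commutative_def by blast
qed

lemma not_fully_commutative_consecutive:
  assumes w: "w \<in> affine_weyl n" and desc: "w (a + 1) < w a" "w (a + 2) < w (a + 1)"
  shows "\<not> fully_commutative n w"
proof -
  obtain i where i: "i \<in> {1..int n}" "cox_gen n i = cox_gen n a"
    using generator_representative .
  obtain j where j: "j \<in> {1..int n}" "cox_gen n j = cox_gen n (a + 1)"
    using generator_representative .
  note s = cox_gen_self[of a] cox_gen_neighbours[of a]
  let ?w1 = "w \<circ> cox_gen n a"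
  let ?w2 = "?w1 \<circ> cox_gen n (a + 1)"
  let ?w3 = "?w2 \<circ> cox_gen n a"
  have w1: "?w1 \<in> affine_weyl n" by (rule affine_weyl_comp_cox_gen[OF w])
  have w2: "?w2 \<in> affine_weyl n" by (rule affine_weyl_comp_cox_gen[OF w1])
  have w3: "?w3 \<in> affine_weyl n" by (rule affine_weyl_comp_cox_gen[OF w2])
  \<comment> \<open>On the three positions \<open>?w1\<close> takes the values
    \<open>w (a + 1), w a, w (a + 2)\<close> and \<open>?w2\<close> the values
    \<open>w (a + 1), w (a + 2), w a\<close>: sorting the triple meets a descent at each
    stage.\<close>
  have d1: "?w1 (a + 1 + 1) < ?w1 (a + 1)" and d2: "?w2 (a + 1) < ?w2 a"
    unfolding add.assoc one_add_one using desc s by simp_all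
  obtain ks where "reduced_expression n ks ?w3"
    using exists_expression[OF w3] reduced_expression_iff[OF w3] by blast
  from reduced_expression_snoc[OF w2 d2 this i]
  have "reduced_expression n (ks @ [i]) ?w2" .
  from reduced_expression_snoc[OF w1 d1 this j]
  have "reduced_expression n ((ks @ [i]) @ [j]) ?w1" .
  from reduced_expression_snoc[OF w desc(1) this i]
  have "reduced_expression n (ks @ [i, j, i] @ []) w" by simp
  then show ?thesis unfolding fully_commutative_def by blast
qed

text \<open>Induction on the number of inversions plus the span \<open>c - a\<close>. While
  \<open>b\<close> is not next to \<open>a\<close>, an ascent at \<open>a\<close> lets
  \<open>a + 1\<close> replace \<open>a\<close>; a descent at \<open>a\<close> lets its generator be
  removed, which lowers the number of inversions without widening the triple. The right end is
  treated likewise, until the positions are consecutive.\<close>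

lemma not_fully_commutative_if_descending_triple:
  assumes "w \<in> affine_weyl n" and "a < b" and "b < c" and "w b < w a" and "w c < w b"
  shows "\<not> fully_commutative n w"
  using assms
proof (induction "nat (int (card (inversions n w)) + (c - a))" arbitrary: w a b c rule: less_induct)
  case less
  note w = less.prems(1) and abc = less.prems(2-5)
  have nc: "a mod int n \<noteq> b mod int n" "b mod int n \<noteq> c mod int n"
    using inversion_not_congruent[OF w] abc by blast+
  have descent: "\<not> fully_commutative n w"
    if i: "w (i + 1) < w i" and p: "\<not> (b = a + 1 \<and> a mod int n = i mod int n)"
      "\<not> (c = b + 1 \<and> b mod int n = i mod int n)"
      and le: "cox_gen n i c - cox_gen n i a \<le> c - a" for i
  proof -
    let ?s = "cox_gen n i"
    have t: "?s a < ?s b" "?s b < ?s c" "(w \<circ> ?s) (?s b) < (w \<circ> ?s) (?s a)"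
      "(w \<circ> ?s) (?s c) < (w \<circ> ?s) (?s b)"
      using descending_triple_comp_cox_gen[of a b c w i] abc p by blast+
    have "nat (int (card (inversions n (w \<circ> ?s))) + (?s c - ?s a)) <
        nat (int (card (inversions n w)) + (c - a))"
      using card_inversions_descent[OF w i] le abc by linarith
    from less.hyps[OF this affine_weyl_comp_cox_gen[OF w] t]
    show ?thesis by (rule not_fully_commutative_descent[OF w i])
  qed
  consider "b \<noteq> a + 1" | "b = a + 1" "c \<noteq> b + 1" | "b = a + 1" "c = a + 2" by force
  then show ?case
  proof cases
    case 1
    show ?thesis
      using ascent_or_descent[OF w, of a]
    proof
      assume "w (a + 1) < w a"
      \<comment> \<open>\<open>c\<close> may move one place to the right, but \<open>a\<close> does
        so too.\<close>
      moreover have "cox_gen n a c \<le> c + 1" by (simp add: cox_gen_def)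
      ultimately show ?thesis using descent[of a] 1 nc(1) cox_gen_self[of a] by simp
    next
      assume "w a < w (a + 1)"
      then show ?thesis using 1 abc by (intro less.hyps[of w c "a + 1" b]) (use w in auto)
    qed
  next
    case 2
    show ?thesis
      using ascent_or_descent[OF w, of "c - 1"]
    proof
      assume "w (c - 1 + 1) < w (c - 1)"
      moreover have "a - 1 \<le> cox_gen n (c - 1) a" by (simp add: cox_gen_def)
      moreover have "cox_gen n (c - 1) c = c - 1" using cox_gen_self[of "c - 1"] by simp
      moreover have "a mod int n \<noteq> (c - 1) mod int n"
        using nc(2) 2(1) mod_add_right_cancel[of a 1 "c - 1"] by simp
      ultimately show ?thesis using descent[of "c - 1"] 2 by simp
    next
      assume "w (c - 1) < w (c - 1 + 1)"
      then show ?thesis using 2 abc by (intro less.hyps[of w "c - 1" a b]) (use w in auto)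
    qed
  next
    case 3
    show ?thesis using not_fully_commutative_consecutive[OF w, of a] abc unfolding 3 by blast
  qed
qed

text \<open>The letters of the factor are appended at ascents, which \<open>a1\<close>,
  \<open>a2\<close>, \<open>a3\<close> express through the prefix \<open>?u\<close>. Equal or
  commuting letters contradict this; adjacent ones make \<open>?u\<close> increase on three
  consecutive positions, whose values the braid reverses.\<close>

lemma not_avoids_321_if_braid:
  assumes red: "reduced_expression n (xs @ [i, j, i] @ ys) w"
  shows "\<not> avoids_321 w"
proof -
  let ?u = "word_prod n xs"
  have asc: "word_prod n ps l < word_prod n ps (l + 1)"
    if "reduced_expression n (ps @ [k] @ qs) w" "l mod int n = k mod int n" for ps k qs l
  proof -
    have "\<not> word_prod n ps (l + 1) < word_prod n ps l"
      using reduced_expression_ascent[OF that(1)] descent_shift[OF word_prod_affine_weyl that(2), of ps]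
      by linarith
    then show ?thesis using ascent_or_descent[OF word_prod_affine_weyl, of ps l] by blast
  qed
  have a1: "?u l < ?u (l + 1)" if "l mod int n = i mod int n" for l
    using asc[of xs i "[j, i] @ ys" l] red that by simp
  have a2: "?u (cox_gen n i l) < ?u (cox_gen n i (l + 1))" if "l mod int n = j mod int n" for l
    using asc[of "xs @ [i]" j "[i] @ ys" l] red that by (simp add: word_prod_append)
  have a3: "?u (cox_gen n i (cox_gen n j l)) < ?u (cox_gen n i (cox_gen n j (l + 1)))"
    if "l mod int n = i mod int n" for l
    using asc[of "xs @ [i, j]" i ys l] red that by (simp add: word_prod_append)
  have x: "word_prod n (xs @ [i, j, i]) t = ?u (cox_gen n i (cox_gen n j (cox_gen n i t)))" for t
    by (simp add: word_prod_append)
  have "\<not> avoids_321 (word_prod n (xs @ [i, j, i]))"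
  proof -
    consider "j mod int n = i mod int n" | "j mod int n = (i + 1) mod int n"
      | "i mod int n = (j + 1) mod int n"
      | "i mod int n \<noteq> j mod int n" "i mod int n \<noteq> (j + 1) mod int n" "(i + 1) mod int n \<noteq> j mod int n"
      by metis
    then show ?thesis
    proof cases
      case 1
      \<comment> \<open>The second letter would be appended at the descent created by the
        first.\<close>
      then show ?thesis using a1[of i] a2[of i] cox_gen_self[of i] by simp
    next
      case 2
      note s = cox_gen_self[of i] cox_gen_neighbours[of i] cox_gen_cong[OF 2]
      have "?u (i + 1) < ?u (i + 2)" using a3[of i] s by simp
      moreover have "?u i < ?u (i + 1)" using a1[of i] by simp
      ultimately have "word_prod n (xs @ [i, j, i]) (i + 2) < word_prod n (xs @ [i, j, i]) (i + 1)"
          "word_prod n (xs @ [i, j, i]) (i + 1) < word_prod n (xs @ [i, j, i]) i"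
        unfolding x using s by simp_all
      then show ?thesis unfolding avoids_321_def by (metis less_add_one add.assoc one_add_one)
    next
      case 3
      \<comment> \<open>Here the triple starts at \<open>j\<close>, so the ascents for the letter
        \<open>i\<close> are read at \<open>j + 1\<close>, which is congruent to
        \<open>i\<close>.\<close>
      note s = cox_gen_self[of j] cox_gen_neighbours[of j] cox_gen_cong[OF 3]
      have "?u j < ?u (j + 1)" using a3[of "j + 1", unfolded add.assoc one_add_one] 3 s by simp
      moreover have "?u (j + 1) < ?u (j + 2)" using a1[of "j + 1", unfolded add.assoc one_add_one] 3 by simp
      ultimately have "word_prod n (xs @ [i, j, i]) (j + 2) < word_prod n (xs @ [i, j, i]) (j + 1)"
          "word_prod n (xs @ [i, j, i]) (j + 1) < word_prod n (xs @ [i, j, i]) j"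
        unfolding x using s by simp_all
      then show ?thesis unfolding avoids_321_def by (metis less_add_one add.assoc one_add_one)
    next
      case 4
      then have "cox_gen n j i = i" "cox_gen n j (i + 1) = i + 1"
        using mod_add_right_cancel[of i 1 j] by (simp_all add: cox_gen_def)
      \<comment> \<open>\<open>s\<^sub>j\<close> fixes \<open>i\<close> and \<open>i + 1\<close>, so
        the last letter meets the descent created by the first.\<close>
      then show ?thesis using a1[of i] a3[of i] cox_gen_self[of i] by simp
    qed
  qed
  then show ?thesis using not_avoids_321_word_prod_append[of "xs @ [i, j, i]" ys w] red by simp
qed

lemma fully_commutative_iff_avoids_321:
  assumes "w \<in> affine_weyl n"
  shows "fully_commutative n w \<longleftrightarrow> avoids_321 w"
proof
  assume "fully_commutative n w"
  then show "avoids_321 w"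
    using not_fully_commutative_if_descending_triple[OF assms] unfolding avoids_321_def by blast
next
  assume "avoids_321 w"
  then show "fully_commutative n w"
    using not_avoids_321_if_braid unfolding fully_commutative_def by blast
qed

subsection \<open>Real roots\<close>

lemma real_root_shift: "real_root n (a + k * int n) (b + k * int n) = real_root n a b"
proof
  fix j
  have "(t + k * int n - j - 1) div int n = (t - j - 1) div int n + k" for t
  proof -
    have "t + k * int n - j - 1 = (t - j - 1) + k * int n" by simp
    then show ?thesis using n_pos by (simp only: div_mult_self1)
  qed
  then show "real_root n (a + k * int n) (b + k * int n) j = real_root n a b j"
    by (simp add: real_root_def)
qed

lemma real_root_simple:
  assumes "k \<in> {1..int n}"
  shows "real_root n k (k + 1) = simple_root k"
proof
  fix j
  show "real_root n k (k + 1) j = simple_root k j"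
  proof (cases "j \<in> {1..int n}")
    case True
    have "(k + 1 - j - 1) div int n - (k - j - 1) div int n = (if (k - j) mod int n = 0 then 1 else 0)"
      using div_step[OF n_pos, of "k - j - 1"] by (simp add: algebra_simps)
    also have "(k - j) mod int n = 0 \<longleftrightarrow> k mod int n = j mod int n"
      by (simp add: mod_eq_0_iff_dvd mod_eq_dvd_iff)
    also have "\<dots> \<longleftrightarrow> j = k"
      by (subst mod_eq_near[OF n_pos]) (use assms True in auto)
    finally show ?thesis using True by (simp only: real_root_def simple_root_def) simp
  next
    case False
    then show ?thesis using assms by (auto simp: real_root_def simple_root_def)
  qed
qed

lemma real_root_step:
  obtains k l where "k \<in> {1..int n}" and "real_root n a (a + 1) = simple_root k" and "a = k + l * int n"
proof -
  obtain k l where kl: "a = k + l * int n" "k \<in> {1..<1 + int n}"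
    using window_representative .
  then have "a + 1 = (k + 1) + l * int n" by simp
  then have "real_root n a (a + 1) = real_root n k (k + 1)"
    using real_root_shift[of k l "k + 1"] kl(1) by metis
  then show ?thesis using that[of k l] kl real_root_simple[of k] by simp
qed

text \<open>Telescoping over consecutive pairs, which give simple roots; the induction runs both
  ways from \<open>a\<close>, so that \<open>b < a\<close> is covered.\<close>

lemma root_pair_real_root:
  assumes f: "\<And>t. f (t + int n) = f t + (c::real)"
  shows "root_pair n (real_root n a b) f = f b - f a"
proof -
  have step: "root_pair n (real_root n a (a + 1)) f = f (a + 1) - f a" for a
  proof -
    obtain k l where kl: "k \<in> {1..int n}" "real_root n a (a + 1) = simple_root k" "a = k + l * int n"
      using real_root_step .
    have "root_pair n (simple_root k) f = (\<Sum>j = 1..int n. if j = k then f (k + 1) - f k else 0)"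
      unfolding root_pair_def simple_root_def by (rule sum.cong) auto
    also have "\<dots> = f (k + 1) - f k" using kl(1) by simp
    also have "\<dots> = f (a + 1) - f a"
      using quasi_periodic_shift[of f "int n" c k l] quasi_periodic_shift[of f "int n" c "k + 1" l] f kl(3)
      by (simp add: algebra_simps)
    finally show ?thesis using kl(2) by simp
  qed
  show ?thesis
  proof (induction b rule: int_induct[where k = a])
    case base
    show ?case by (simp add: real_root_def root_pair_def)
  next
    case (step1 b)
    then show ?case
      using root_pair_add[of n "real_root n a b" "real_root n b (b + 1)" f] step[of b]
      by (simp add: real_root_add_fun)
  next
    case (step2 b)
    then show ?case
      using root_pair_add[of n "real_root n a (b - 1)" "real_root n (b - 1) b" f] step[of "b - 1"]
      by (simp add: real_root_add_fun)
  qed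
qed

lemma vector_eqI:
  assumes "\<And>k. k \<notin> {1..int n} \<Longrightarrow> u k = v k"
    and "\<And>f. (\<And>t. f (t + int n) = f t + (1::real)) \<Longrightarrow> root_pair n u f = root_pair n v f"
  shows "u = v"
proof
  fix k
  show "u k = v k"
  proof (cases "k \<in> {1..int n}")
    case True
    obtain f where "\<And>t. f (t + int n) = f t + (1::real)" "\<And>v. root_pair n v f = v k"
      using root_pair_separates[OF n True] by blast
    then show ?thesis using assms(2)[of f] by simp
  qed (use assms(1) in blast)
qed

text \<open>Reflections are adjoint to composition with generators, so both sides have equal
  pairings, and pairings separate the coordinates.\<close>

lemma simple_refl_real_root:
  assumes i: "i \<in> {1..int n}"
  shows "simple_refl n i (real_root n a b) = real_root n (cox_gen n i a) (cox_gen n i b)"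
proof (rule vector_eqI)
  show "simple_refl n i (real_root n a b) k = real_root n (cox_gen n i a) (cox_gen n i b) k"
    if "k \<notin> {1..int n}" for k
    unfolding simple_refl_outside[OF i that] using that by (auto simp: real_root_def)
next
  fix f :: "int \<Rightarrow> real" assume f: "\<And>t. f (t + int n) = f t + 1"
  have fs: "(f \<circ> cox_gen n i) (t + int n) = (f \<circ> cox_gen n i) t + 1" for t
    by (simp add: cox_gen_periodic f)
  show "root_pair n (simple_refl n i (real_root n a b)) f =
      root_pair n (real_root n (cox_gen n i a) (cox_gen n i b)) f"
    unfolding root_pair_simple_refl[where f = f, OF n i f]
      root_pair_real_root[where f = f, OF f] root_pair_real_root[where f = "f \<circ> cox_gen n i", OF fs]
    by simp
qed

lemma cox_gen_mod_eq_iff: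
  "cox_gen n i a mod int n = cox_gen n i b mod int n \<longleftrightarrow> a mod int n = b mod int n"
  using affine_weyl_mod_eq_iff[OF word_prod_affine_weyl, of "[i]" a b] by simp

lemma roots_uminus:
  assumes "\<alpha> \<in> roots n"
  shows "(\<lambda>k. - \<alpha> k) \<in> roots n"
  using assms
proof induction
  case (simple i)
  have "simple_refl n i (simple_root i) = (\<lambda>k. - simple_root i k)"
    unfolding real_root_simple[OF simple, symmetric] simple_refl_real_root[OF simple] cox_gen_self
    by (rule real_root_uminus)
  then show ?case using roots.refl[OF roots.simple[OF simple] simple] by simp
next
  case (refl \<alpha> i)
  then show ?case using roots.refl[OF refl.IH refl.hyps(2)] by (simp add: simple_refl_uminus)
qed

text \<open>Induction on \<open>b - a\<close>: the generator at \<open>a\<close> moves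
  \<open>a\<close> to \<open>a + 1\<close> and does not move \<open>b\<close> up, so the pair gets
  closer until the root is simple.\<close>

lemma real_root_in_roots_less:
  assumes "a < b" and "a mod int n \<noteq> b mod int n"
  shows "real_root n a b \<in> roots n"
  using assms
proof (induction "nat (b - a)" arbitrary: a b rule: less_induct)
  case less
  show ?case
  proof (cases "b = a + 1")
    case True
    obtain k l where "k \<in> {1..int n}" "real_root n a (a + 1) = simple_root k" "a = k + l * int n"
      using real_root_step .
    then show ?thesis using True roots.simple by simp
  next
    case False
    obtain k where k: "k \<in> {1..int n}" "cox_gen n k = cox_gen n a"
      using generator_representative .
    have b: "cox_gen n a b \<le> b" using less.prems(2) by (auto simp: cox_gen_def)
    have "cox_gen n a b \<noteq> a + 1"
      using False less.prems cox_gen_self[of a] by (metis cox_gen_involution less_irrefl)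
    moreover have "a + 1 \<le> cox_gen n a b" using False less.prems by (auto simp: cox_gen_def)
    ultimately have "real_root n (cox_gen n a a) (cox_gen n a b) \<in> roots n"
      using less.prems b by (intro less.hyps) (auto simp: cox_gen_self cox_gen_mod_eq_iff
        simp flip: cox_gen_mod_eq_iff[of a a b])
    from roots.refl[OF this k(1)] show ?thesis
      unfolding simple_refl_real_root[OF k(1)] k(2) by simp
  qed
qed

text \<open>Congruent entries are excluded because they give multiples of the null root.\<close>

lemma real_root_in_roots:
  assumes "a mod int n \<noteq> b mod int n"
  shows "real_root n a b \<in> roots n"
proof -
  have "a < b \<or> b < a" using assms by (metis not_less_iff_gr_or_eq)
  then show ?thesis
    using real_root_in_roots_less[of a b] roots_uminus[OF real_root_in_roots_less[of b a]] assms
      real_root_uminus[of n a b] by auto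
qed

lemma roots_cases:
  assumes "\<alpha> \<in> roots n"
  obtains a b where "\<alpha> = real_root n a b" and "a mod int n \<noteq> b mod int n"
  using assms
proof (induction arbitrary: thesis)
  case (simple i)
  show ?case
    using simple.prems[of i "i + 1"] real_root_simple[OF simple.hyps] mod_add_small_neq[of 1 i] by simp
next
  case (refl \<alpha> i)
  obtain a b where "\<alpha> = real_root n a b" "a mod int n \<noteq> b mod int n" using refl.IH .
  then show ?case
    using refl.prems[of "cox_gen n i a" "cox_gen n i b"] simple_refl_real_root[OF refl.hyps(2)]
    by (simp add: cox_gen_mod_eq_iff)
qed

section \<open>Signs of roots and the action of the group\<close>

lemma real_root_nonneg: "a \<le> b \<Longrightarrow> 0 \<le> real_root n a b k"
  using n_pos by (auto simp: real_root_def intro!: zdiv_mono1)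

lemma real_root_eq_0_iff: "(\<forall>k. real_root n a b k = 0) \<longleftrightarrow> a = b"
proof
  assume "\<forall>k. real_root n a b k = 0"
  \<comment> \<open>Pairing with the inclusion of the integers recovers
    \<open>b - a\<close>.\<close>
  then have "root_pair n (real_root n a b) real_of_int = 0" by (simp add: root_pair_def)
  then show "a = b" using root_pair_real_root[of real_of_int "int n" a b] by simp
qed (simp add: real_root_def)

lemma real_root_sign:
  assumes "a \<noteq> b"
  shows "(\<forall>k. 0 \<le> real_root n a b k) \<longleftrightarrow> a < b"
proof
  assume *: "\<forall>k. 0 \<le> real_root n a b k"
  show "a < b"
  proof (rule ccontr)
    assume "\<not> a < b"
    then have "real_root n a b k \<le> 0" for k
      using real_root_nonneg[of b a k] real_root_uminus[of n a b] by simp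
    then have "\<forall>k. real_root n a b k = 0" using * antisym by blast
    then show False using real_root_eq_0_iff assms by blast
  qed
qed (simp add: real_root_nonneg)

lemma real_root_positive_iff:
  assumes "a mod int n \<noteq> b mod int n"
  shows "real_root n a b \<in> positive_roots n \<longleftrightarrow> a < b"
  using real_root_in_roots[OF assms] real_root_sign[of a b] assms by (auto simp: positive_roots_def)

lemma real_root_negative_iff:
  assumes "a mod int n \<noteq> b mod int n"
  shows "real_root n a b \<in> negative_roots n \<longleftrightarrow> b < a"
proof -
  have "(\<forall>k. real_root n a b k \<le> 0) \<longleftrightarrow> (\<forall>k. 0 \<le> real_root n b a k)"
    using real_root_uminus[of n a b] by simp
  then show ?thesis
    using real_root_in_roots[OF assms] real_root_sign[of b a] assms by (auto simp: negative_roots_def)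
qed

lemma weyl_act_real_root:
  assumes "w \<in> affine_weyl n"
  shows "weyl_act n w (real_root n a b) = real_root n (w a) (w b)"
proof -
  obtain ks where ks: "set ks \<subseteq> {1..int n}" "word_prod n ks = w"
    using exists_expression[OF assms] unfolding expression_def by blast
  have "foldr (simple_refl n) ks (real_root n a b) =
      real_root n (word_prod n ks a) (word_prod n ks b)"
    using ks(1) by (induction ks) (simp_all add: simple_refl_real_root)
  then show ?thesis using weyl_act_word_prod[OF n ks(1)] ks(2) by simp
qed

text \<open>Pairing with the indicator functions of the residue classes modulo \<open>n\<close>.\<close>

lemma real_root_sum_congruent:
  assumes sum: "(\<lambda>k. real_root n a b k + real_root n c d k) = real_root n e g"
    and ab: "a mod int n \<noteq> b mod int n" and cd: "c mod int n \<noteq> d mod int n"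
  shows "b mod int n = c mod int n \<or> a mod int n = d mod int n"
proof (rule ccontr)
  assume *: "\<not> ?thesis"
  define f where "f r t = (if t mod int n = r mod int n then 1 else 0 :: real)" for r t
  have "f r b - f r a + (f r d - f r c) = f r g - f r e" for r
  proof -
    have p: "f r (t + int n) = f r t + 0" for t by (simp add: f_def)
    show ?thesis
      using root_pair_add[of n "real_root n a b" "real_root n c d" "f r"]
      unfolding sum root_pair_real_root[where f = "f r", OF p] by simp
  qed
  \<comment> \<open>The left side is at least 1 in the classes of \<open>b\<close> and of
    \<open>d\<close>, so both are the class of \<open>g\<close>; there the left side is then 2, but
    the right side is at most 1.\<close>
  from this[of b] this[of d] show False
    using * ab cd by (auto simp: f_def split: if_splits)
qed

text \<open>Inversions of \<open>w\<close> correspond to positive roots that \<open>w\<close> makes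
  negative. A pattern \<open>a < b < c\<close> splits the root of \<open>(a, c)\<close> into those
  of \<open>(a, b)\<close> and \<open>(b, c)\<close>.\<close>

lemma avoids_321_iff_roots:
  assumes w: "w \<in> affine_weyl n"
  shows "avoids_321 w \<longleftrightarrow>
    \<not> (\<exists>\<alpha> \<beta>. \<alpha> \<in> positive_roots n \<and> \<beta> \<in> positive_roots n
        \<and> (\<lambda>i. \<alpha> i + \<beta> i) \<in> positive_roots n
        \<and> weyl_act n w \<alpha> \<in> negative_roots n
        \<and> weyl_act n w \<beta> \<in> negative_roots n)" (is "_ \<longleftrightarrow> \<not> ?R")
proof -
  have "?R" if "\<not> avoids_321 w"
  proof -
    obtain a b c where abc: "a < b" "b < c" "w b < w a" "w c < w b"
      using \<open>\<not> avoids_321 w\<close> unfolding avoids_321_def by blast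
    have nc: "a mod int n \<noteq> b mod int n" "b mod int n \<noteq> c mod int n" "a mod int n \<noteq> c mod int n"
      using inversion_not_congruent[OF w, of a b] inversion_not_congruent[OF w, of b c]
        inversion_not_congruent[OF w, of a c] abc by auto
    then have "real_root n a b \<in> positive_roots n" "real_root n b c \<in> positive_roots n"
        "(\<lambda>k. real_root n a b k + real_root n b c k) \<in> positive_roots n"
      using abc unfolding real_root_add_fun by (simp_all add: real_root_positive_iff)
    moreover have "weyl_act n w (real_root n a b) \<in> negative_roots n"
        "weyl_act n w (real_root n b c) \<in> negative_roots n"
      using nc abc unfolding weyl_act_real_root[OF w]
      by (simp_all add: real_root_negative_iff affine_weyl_mod_eq_iff[OF w])
    ultimately show ?R by blast
  qed
  moreover have "\<not> avoids_321 w" if R: ?R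
  proof -
    obtain \<alpha> \<beta> where pos: "\<alpha> \<in> positive_roots n" "\<beta> \<in> positive_roots n"
        "(\<lambda>i. \<alpha> i + \<beta> i) \<in> positive_roots n"
      and neg: "weyl_act n w \<alpha> \<in> negative_roots n" "weyl_act n w \<beta> \<in> negative_roots n"
      using R by blast
    have rt: "\<alpha> \<in> roots n" "\<beta> \<in> roots n" "(\<lambda>i. \<alpha> i + \<beta> i) \<in> roots n"
      using pos by (auto simp: positive_roots_def)
    obtain a b where ab: "\<alpha> = real_root n a b" "a mod int n \<noteq> b mod int n"
      using roots_cases[OF rt(1)] .
    obtain c d where cd: "\<beta> = real_root n c d" "c mod int n \<noteq> d mod int n"
      using roots_cases[OF rt(2)] .
    obtain e g where eg: "(\<lambda>i. \<alpha> i + \<beta> i) = real_root n e g"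
      using roots_cases[OF rt(3)] by metis
    have less: "a < b" "c < d" "w b < w a" "w d < w c"
      using pos neg ab cd weyl_act_real_root[OF w]
      by (simp_all add: real_root_positive_iff real_root_negative_iff affine_weyl_mod_eq_iff[OF w])
    \<comment> \<open>Covers both ways in which the pairs can meet: the second pair is shifted so
      that it starts where the first one ends.\<close>
    have triple: False if av: "avoids_321 w" and tr: "p < q" "w q < w p" "r < s" "w s < w r"
      "r mod int n = q mod int n" for p q r s
    proof -
      obtain k where k: "q = r + k * int n" using tr(5) by (rule eq_add_mult_if_mod_eq)
      have "w q = w r + k * int n" "w (s + k * int n) = w s + k * int n" "q < s + k * int n"
        using affine_weyl_shift[OF w] k tr(3) by simp_all
      then have "p < q \<and> q < s + k * int n \<and> w q < w p \<and> w (s + k * int n) < w q"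
        using tr by simp
      then show False using av unfolding avoids_321_def by blast
    qed
    have "b mod int n = c mod int n \<or> a mod int n = d mod int n"
      using real_root_sum_congruent[of a b c d e g] eg ab cd by simp
    then show ?thesis
      using triple[of a b c d] triple[of c d a b] less by metis
  qed
  ultimately show ?thesis by blast
qed

end

theorem theorem2p7:
  fixes n :: nat and w :: "int \<Rightarrow> int"
  assumes "n \<ge> 3" and "w \<in> affine_weyl n"
  shows "(fully_commutative n w \<longleftrightarrow>
            (\<forall>a b. a < b \<and> w a > w b \<longrightarrow> w a > a \<and> w b < b))
       \<and> ((\<forall>a b. a < b \<and> w a > w b \<longrightarrow> w a > a \<and> w b < b) \<longleftrightarrow>
            avoids_321 w)
       \<and> (avoids_321 w \<longleftrightarrow>
            \<not> (\<exists>\<alpha> \<beta>. \<alpha> \<in> positive_roots n \<and> \<beta> \<in> positive_roots n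
                \<and> (\<lambda>i. \<alpha> i + \<beta> i) \<in> positive_roots n
                \<and> weyl_act n w \<alpha> \<in> negative_roots n
                \<and> weyl_act n w \<beta> \<in> negative_roots n))"
  using fully_commutative_iff_avoids_321[OF assms] avoids_321_iff[OF assms]
    avoids_321_iff_roots[OF assms] by argo

end
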